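(* (1) If $R$ is an $n$-Peirce ring ($n>1$), then there is a complete set of orthogonal idempotents $\{e_i\}_{i=1}^n\subseteq\mathfrak{P}_{\rm it}(R)$ (hence $R^\pi\in\mathcal{T}_n$) such that every $e_iRe_i$ is a $1$-Peirce ring. (2) If a ring $R$ has a complete set $\{e_i\}_{i=1}^n$ of orthogonal idempotents for some $n\geq2$ such that every $e_iRe_i$ is a $1$-Peirce ring, then $R$ is a $k$-Peirce ring for some $1\leq k\leq n$.
   Context: All rings are associative with unity. A complete set of orthogonal idempotents is a set of pairwise orthogonal idempotents with sum $1$. For an idempotent $e\in R$: $e$ is inner Peirce trivial if $eR(1-e)Re=0$; outer Peirce trivial if $(1-e)ReR(1-e)=0$; Peirce trivial if both. $\mathfrak{P}_{\rm it}(R)$ and $\mathfrak{P}_{\rm t}(R)$ denote the sets of inner Peirce trivial and of Peirce trivial idempotents of $R$. A ring $R$ is a $1$-Peirce ring if $\mathfrak{P}_{\rm t}(R)=\{0,1\}$ with $0\neq1$. Inductively, for $n>1$, $R$ is an $n$-Peirce ring if there is $e\in\mathfrak{P}_{\rm t}(R)$ such that $eRe$ is an $m$-Peirce ring for some $1\leq m<n$ and $(1-e)R(1-e)$ is an $(n-m)$-Peirce ring. $R^\pi$ is the $n$-by-$n$ generalized matrix ring with $(i,j)$-position $e_iRe_j$ and row-column multiplication induced by $R$; $R^\pi\in\mathcal{T}_n$ means that the product maps $e_iRe_j\otimes_{e_jRe_j}e_jRe_i\to e_iRe_i$ are zero for all $i\neq j$. *)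

theory Defs
  imports "HOL-Algebra.Ideal_Product"
begin

definition idempotents :: "('a, 'b) ring_scheme \<Rightarrow> 'a set" where
  "idempotents R = {e \<in> carrier R. e \<otimes>\<^bsub>R\<^esub> e = e}"

text \<open>The Peirce component \<open>eRf\<close>.\<close>

definition peirce_comp :: "('a, 'b) ring_scheme \<Rightarrow> 'a \<Rightarrow> 'a \<Rightarrow> 'a set" where
  "peirce_comp R e f = {e \<otimes>\<^bsub>R\<^esub> x \<otimes>\<^bsub>R\<^esub> f | x. x \<in> carrier R}"

text \<open>The ring \<open>eRe\<close>: its unity is \<open>e\<close>; multiplication, addition and zero are those of \<open>R\<close>.\<close>

definition corner_ring :: "('a, 'b) ring_scheme \<Rightarrow> 'a \<Rightarrow> ('a, 'b) ring_scheme" where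
  "corner_ring R e = R\<lparr>carrier := peirce_comp R e e, one := e\<rparr>"

text \<open>
  \<^const>\<open>ideal_prod\<close> applied to additive subgroups \<open>A\<close> and \<open>B\<close> is the set of all finite sums of
  products \<open>ab\<close>.  In particular the product of \<open>eR(1-e)\<close> and \<open>(1-e)Re\<close> is \<open>eR(1-e)Re\<close>.
\<close>

definition inner_peirce_trivial :: "('a, 'b) ring_scheme \<Rightarrow> 'a set" where
  "inner_peirce_trivial R =
     {e \<in> idempotents R.
        peirce_comp R e (\<one>\<^bsub>R\<^esub> \<ominus>\<^bsub>R\<^esub> e) \<cdot>\<^bsub>R\<^esub> peirce_comp R (\<one>\<^bsub>R\<^esub> \<ominus>\<^bsub>R\<^esub> e) e = {\<zero>\<^bsub>R\<^esub>}}"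

definition outer_peirce_trivial :: "('a, 'b) ring_scheme \<Rightarrow> 'a set" where
  "outer_peirce_trivial R =
     {e \<in> idempotents R.
        peirce_comp R (\<one>\<^bsub>R\<^esub> \<ominus>\<^bsub>R\<^esub> e) e \<cdot>\<^bsub>R\<^esub> peirce_comp R e (\<one>\<^bsub>R\<^esub> \<ominus>\<^bsub>R\<^esub> e) = {\<zero>\<^bsub>R\<^esub>}}"

definition peirce_trivial :: "('a, 'b) ring_scheme \<Rightarrow> 'a set" where
  "peirce_trivial R = inner_peirce_trivial R \<inter> outer_peirce_trivial R"

inductive n_peirce_ring :: "nat \<Rightarrow> ('a, 'b) ring_scheme \<Rightarrow> bool" where
  one_peirce:
    "\<lbrakk>ring R; peirce_trivial R = {\<zero>\<^bsub>R\<^esub>, \<one>\<^bsub>R\<^esub>}; \<zero>\<^bsub>R\<^esub> \<noteq> \<one>\<^bsub>R\<^esub>\<rbrakk> \<Longrightarrow> n_peirce_ring 1 R"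
| step:
    "\<lbrakk>ring R; n > 1; e \<in> peirce_trivial R; 1 \<le> m; m < n;
      n_peirce_ring m (corner_ring R e);
      n_peirce_ring (n - m) (corner_ring R (\<one>\<^bsub>R\<^esub> \<ominus>\<^bsub>R\<^esub> e))\<rbrakk> \<Longrightarrow> n_peirce_ring n R"

definition complete_orthogonal_idempotents ::
  "('a, 'b) ring_scheme \<Rightarrow> nat \<Rightarrow> (nat \<Rightarrow> 'a) \<Rightarrow> bool" where
  "complete_orthogonal_idempotents R n e \<longleftrightarrow>
     (\<forall>i\<in>{1..n}. e i \<in> idempotents R) \<and>
     (\<forall>i\<in>{1..n}. \<forall>j\<in>{1..n}. i \<noteq> j \<longrightarrow> e i \<otimes>\<^bsub>R\<^esub> e j = \<zero>\<^bsub>R\<^esub>) \<and>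
     (\<Oplus>\<^bsub>R\<^esub>i\<in>{1..n}. e i) = \<one>\<^bsub>R\<^esub>"

text \<open>
  The generalized matrix ring \<open>R\<^sup>\<pi>\<close>, with \<open>(i,j)\<close>-position \<open>e i R e j\<close>.  Matrices are functions on
  \<open>{1..n} \<times> {1..n}\<close>, made extensional by requiring the value zero elsewhere.
\<close>

definition peirce_matrix_ring ::
  "('a, 'b) ring_scheme \<Rightarrow> nat \<Rightarrow> (nat \<Rightarrow> 'a) \<Rightarrow> (nat \<Rightarrow> nat \<Rightarrow> 'a) ring" where
  "peirce_matrix_ring R n e =
     \<lparr>carrier = {M. \<forall>i j. (if i \<in> {1..n} \<and> j \<in> {1..n}
                           then M i j \<in> peirce_comp R (e i) (e j) else M i j = \<zero>\<^bsub>R\<^esub>)},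
      mult = (\<lambda>M N i j. \<Oplus>\<^bsub>R\<^esub>k\<in>{1..n}. M i k \<otimes>\<^bsub>R\<^esub> N k j),
      one = (\<lambda>i j. if i \<in> {1..n} \<and> i = j then e i else \<zero>\<^bsub>R\<^esub>),
      zero = (\<lambda>i j. \<zero>\<^bsub>R\<^esub>),
      add = (\<lambda>M N i j. M i j \<oplus>\<^bsub>R\<^esub> N i j)\<rparr>"

text \<open>
  The class \<open>T\<^sub>n\<close> of generalized matrix rings \<open>A\<close>.  Write \<open>A i j\<close> for the \<open>(i,j)\<close>-position of \<open>A\<close>,
  identified with the matrices supported at \<open>(i,j)\<close>.  The product map from the tensor product of
  \<open>A i j\<close> and \<open>A j i\<close> to \<open>A i i\<close> sends \<open>x \<otimes> y\<close> to the \<open>(i,i)\<close>-entry of the product of the matrices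
  \<open>M\<close> and \<open>N\<close> with single entries \<open>x\<close> and \<open>y\<close>.  Being additive, it is zero iff it is zero on all
  pure tensors.
\<close>

definition supported_at :: "(nat \<Rightarrow> nat \<Rightarrow> 'a) ring \<Rightarrow> nat \<Rightarrow> nat \<Rightarrow> (nat \<Rightarrow> nat \<Rightarrow> 'a) set" where
  "supported_at A i j = {M \<in> carrier A. \<forall>k l. (k, l) \<noteq> (i, j) \<longrightarrow> M k l = \<zero>\<^bsub>A\<^esub> k l}"

definition T_class :: "nat \<Rightarrow> (nat \<Rightarrow> nat \<Rightarrow> 'a) ring set" where
  "T_class n =
     {A. \<forall>i\<in>{1..n}. \<forall>j\<in>{1..n}. i \<noteq> j \<longrightarrow>
           (\<forall>M\<in>supported_at A i j. \<forall>N\<in>supported_at A j i. (M \<otimes>\<^bsub>A\<^esub> N) i i = \<zero>\<^bsub>A\<^esub> i i)}"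

end

theory Submission
  imports Defs "HOL-Algebra.QuotRing"
begin

text \<open>
  Write \<open>u = 1 - e\<close>.  All conditions on \<open>e\<close> are used elementwise: inner Peirce triviality says
  \<open>e x u y e = 0\<close> for all \<open>x\<close> and \<open>y\<close>, and outer Peirce triviality of \<open>e\<close> is inner Peirce triviality
  of \<open>u\<close>.

  From an \<open>n\<close>-Peirce ring to a family of idempotents: the recursive definition is a binary tree of
  corners whose \<open>n\<close> leaves are \<open>1\<close>-Peirce rings, and the unities of the leaves are the required
  idempotents.  The point is that inner Peirce triviality is transitive
  (\<open>inner_peirce_trivial_corner\<close>): an inner Peirce trivial idempotent of \<open>eRe\<close> is one of \<open>R\<close> when \<open>e\<close>
  itself is.

  From a family \<open>a i\<close> of idempotents with \<open>1\<close>-Peirce corners to a \<open>k\<close>-Peirce ring: if \<open>R\<close> is not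
  \<open>1\<close>-Peirce, there is a Peirce trivial \<open>e\<close> other than \<open>0\<close> and \<open>1\<close>.  It need not commute with the \<open>a i\<close>,
  but two facts replace this.  First, \<open>f e f\<close> is a Peirce trivial idempotent of \<open>f R f\<close> for every
  idempotent \<open>f\<close> (\<open>peirce_trivial_compression\<close>), so that \<open>a i e a i\<close> is \<open>0\<close> or \<open>a i\<close>.  Secondly,
  \<open>x \<mapsto> e x e\<close> is a ring homomorphism onto \<open>e R e\<close> (\<open>inner_peirce_trivial_hom\<close>), and it sends
  the family to a complete orthogonal family of \<open>e R e\<close>.  Members with \<open>a i e a i = 0\<close> go to \<open>0\<close>; those
  with \<open>a i e a i = a i\<close> go to isomorphic idempotents, whose corners are again \<open>1\<close>-Peirce
  (\<open>compressed_family\<close>).  For \<open>u\<close> the two cases are exchanged, so \<open>e R e\<close> and \<open>u R u\<close> share the family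
  between them, each receiving at least one member, and induction on its size applies to both
  (\<open>n_peirce_of_family\<close>).  Members are never split further, so the number \<open>k\<close> of leaves is at most
  the size of the family.
\<close>

section \<open>Corner rings and complete orthogonal families\<close>

text \<open>
  The symmetric form of "\<open>e\<close> idempotent and \<open>u = 1 - e\<close>".  Exchanging \<open>e\<close> and \<open>u\<close> exchanges inner
  and outer Peirce triviality, so one half of each argument gives the other; and no additive
  inverse has to be carried into a corner ring.
\<close>

definition complementary :: "('a, 'b) ring_scheme \<Rightarrow> 'a \<Rightarrow> 'a \<Rightarrow> bool" where
  "complementary R e u \<longleftrightarrow> e \<in> carrier R \<and> u \<in> carrier R \<and>
     e \<oplus>\<^bsub>R\<^esub> u = \<one>\<^bsub>R\<^esub> \<and> e \<otimes>\<^bsub>R\<^esub> u = \<zero>\<^bsub>R\<^esub> \<and> u \<otimes>\<^bsub>R\<^esub> e = \<zero>\<^bsub>R\<^esub>"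

text \<open>
  Arbitrary index sets allow the induction to split a family along a subset of its indices
  without renumbering.
\<close>

definition complete_orthogonal_family :: "('a, 'b) ring_scheme \<Rightarrow> 'i set \<Rightarrow> ('i \<Rightarrow> 'a) \<Rightarrow> bool" where
  "complete_orthogonal_family R I a \<longleftrightarrow>
     (\<forall>i\<in>I. a i \<in> idempotents R) \<and>
     (\<forall>i\<in>I. \<forall>j\<in>I. i \<noteq> j \<longrightarrow> a i \<otimes>\<^bsub>R\<^esub> a j = \<zero>\<^bsub>R\<^esub>) \<and>
     (\<Oplus>\<^bsub>R\<^esub>i\<in>I. a i) = \<one>\<^bsub>R\<^esub>"

lemma corner_ring_simps [simp]:
  "mult (corner_ring R e) = mult R" "add (corner_ring R e) = add R"
  "zero (corner_ring R e) = zero R" "one (corner_ring R e) = e"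
  by (simp_all add: corner_ring_def)

context ring
begin

lemma idempotentsD:
  assumes "e \<in> idempotents R"
  shows "e \<in> carrier R" and "e \<otimes> e = e" and "y \<in> carrier R \<Longrightarrow> e \<otimes> (e \<otimes> y) = e \<otimes> y"
proof -
  show e: "e \<in> carrier R" and ee: "e \<otimes> e = e"
    using assms by (simp_all add: idempotents_def)
  show "e \<otimes> (e \<otimes> y) = e \<otimes> y" if "y \<in> carrier R"
    using that e ee by (simp flip: m_assoc)
qed

lemma sandwich_in_corner: "e \<in> carrier R \<Longrightarrow> x \<in> carrier R \<Longrightarrow> e \<otimes> x \<otimes> e \<in> carrier (corner_ring R e)"
  by (auto simp: corner_ring_def peirce_comp_def)

lemma corner_carrier_iff:
  assumes "e \<in> idempotents R"
  shows "x \<in> carrier (corner_ring R e) \<longleftrightarrow> x \<in> carrier R \<and> e \<otimes> x = x \<and> x \<otimes> e = x"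
proof -
  note e = idempotentsD[OF assms]
  have "x \<in> carrier (corner_ring R e)" if "x \<in> carrier R" "e \<otimes> x = x" "x \<otimes> e = x"
    using sandwich_in_corner[of e x] that e by simp
  then show ?thesis
    using e by (auto simp: corner_ring_def peirce_comp_def m_assoc)
qed

lemma corner_ring_is_ring:
  assumes "e \<in> idempotents R"
  shows "ring (corner_ring R e)"
proof -
  note e = idempotentsD[OF assms] and c = corner_carrier_iff[OF assms]
  show ?thesis
  proof (intro ringI abelian_groupI monoidI)
    fix x assume "x \<in> carrier (corner_ring R e)"
    then show "\<exists>y\<in>carrier (corner_ring R e). y \<oplus>\<^bsub>corner_ring R e\<^esub> x = \<zero>\<^bsub>corner_ring R e\<^esub>"
      by (intro bexI[of _ "\<ominus> x"]) (auto simp: c e l_neg r_minus l_minus)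
  qed (auto simp: c e a_ac m_assoc l_distr r_distr simp flip: m_assoc, metis e(1) m_assoc)
qed

lemma corner_one: "corner_ring R \<one> = R"
proof -
  have "peirce_comp R \<one> \<one> = carrier R"
    by (force simp: peirce_comp_def)
  then show ?thesis
    by (simp add: corner_ring_def)
qed

lemma corner_of_corner:
  assumes "e \<in> idempotents R" "f \<in> carrier (corner_ring R e)"
  shows "corner_ring (corner_ring R e) f = corner_ring R f"
proof -
  note e = idempotentsD[OF assms(1)]
  have f: "f \<in> carrier R" "e \<otimes> f = f" "f \<otimes> e = f"
    using assms corner_carrier_iff by auto
  have "f \<otimes> x \<otimes> f = f \<otimes> (e \<otimes> x \<otimes> e) \<otimes> f" if "x \<in> carrier R" for x
    using that e f by (metis m_assoc m_closed)
  then have "peirce_comp (corner_ring R e) f f = peirce_comp R f f"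
    using e f sandwich_in_corner[of e] corner_carrier_iff[OF assms(1)]
    unfolding peirce_comp_def by auto
  then show ?thesis
    by (simp add: corner_ring_def)
qed

lemma finsum_corner:
  assumes e: "e \<in> idempotents R" and "finite I" "g \<in> I \<rightarrow> carrier (corner_ring R e)"
  shows "finsum (corner_ring R e) g I = finsum R g I"
proof -
  interpret C: ring "corner_ring R e" by (rule corner_ring_is_ring[OF e])
  have cR: "x \<in> carrier R" if "x \<in> carrier (corner_ring R e)" for x
    using that corner_carrier_iff[OF e] by blast
  show ?thesis using assms(2,3)
  proof (induction I)
    case (insert i I)
    then show ?case
      by (simp add: C.finsum_insert finsum_insert Pi_iff cR)
  qed (simp add: C.finsum_empty)
qed

section \<open>Complementary pairs and Peirce triviality\<close>

lemma complementaryD: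
  assumes "complementary R e u"
  shows "e \<in> carrier R" "u \<in> carrier R" "e \<oplus> u = \<one>" "e \<otimes> u = \<zero>" "u \<otimes> e = \<zero>"
  using assms by (auto simp: complementary_def)

lemma complementary_sym: "complementary R e u \<Longrightarrow> complementary R u e"
  by (auto simp: complementary_def a_comm)

lemma complementary_idem:
  assumes "complementary R e u" shows "e \<in> idempotents R"
proof -
  note c = complementaryD[OF assms]
  have "e \<otimes> e = e \<otimes> (e \<oplus> u)" using c(1,2,4) by (subst r_distr) auto
  then show ?thesis using c by (simp add: idempotents_def)
qed

lemma complementary_eq:
  assumes "complementary R e u" shows "\<one> \<ominus> e = u"
proof -
  note c = complementaryD[OF assms]
  have "\<one> \<ominus> e = (u \<oplus> e) \<ominus> e" using c by (simp add: a_comm)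
  also have "\<dots> = u" using c(1,2)
    by (simp add: minus_eq a_assoc r_neg)
  finally show ?thesis .
qed

lemma complementary_one_minus:
  assumes "e \<in> idempotents R" shows "complementary R e (\<one> \<ominus> e)"
proof -
  note e = idempotentsD[OF assms]
  have "e \<oplus> (\<one> \<ominus> e) = \<one>" using e(1) by (simp add: minus_eq a_comm[of \<one>] r_neg2)
  moreover have "e \<otimes> (\<one> \<ominus> e) = \<zero>" "(\<one> \<ominus> e) \<otimes> e = \<zero>"
    using e by (simp_all add: minus_eq r_distr l_distr r_minus l_minus r_neg)
  ultimately show ?thesis using e by (simp add: complementary_def)
qed

lemma inner_peirce_trivial_iff:
  assumes c: "complementary R e u"
  shows "e \<in> inner_peirce_trivial R \<longleftrightarrow>
    (\<forall>x\<in>carrier R. \<forall>y\<in>carrier R. e \<otimes> x \<otimes> u \<otimes> y \<otimes> e = \<zero>)" (is "_ \<longleftrightarrow> ?zero")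
proof -
  note e = idempotentsD[OF complementary_idem[OF c]]
    and u = idempotentsD[OF complementary_idem[OF complementary_sym[OF c]]]
  let ?P = "peirce_comp R e u \<cdot> peirce_comp R u e"
  have prod: "e \<otimes> x \<otimes> u \<otimes> (u \<otimes> y \<otimes> e) = e \<otimes> x \<otimes> u \<otimes> y \<otimes> e"
    if "x \<in> carrier R" "y \<in> carrier R" for x y
    using that e u by (simp add: m_assoc)
  have "?P = {\<zero>} \<longleftrightarrow> ?zero"
  proof
    assume P: "?P = {\<zero>}"
    have "e \<otimes> x \<otimes> u \<otimes> (u \<otimes> y \<otimes> e) \<in> ?P" if "x \<in> carrier R" "y \<in> carrier R" for x y
      using that by (intro ideal_prod.prod) (auto simp: peirce_comp_def)
    then show ?zero using P prod by simp
  next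
    assume z: ?zero
    have "s = \<zero>" if "s \<in> ?P" for s
      using that by induction (auto simp: peirce_comp_def prod z)
    moreover have "e \<otimes> \<zero> \<otimes> u \<otimes> (u \<otimes> \<zero> \<otimes> e) \<in> ?P"
      by (intro ideal_prod.prod) (auto simp: peirce_comp_def)
    then have "\<zero> \<in> ?P" using e u by simp
    ultimately show "?P = {\<zero>}" by blast
  qed
  then show ?thesis
    using complementary_eq[OF c] complementary_idem[OF c] by (simp add: inner_peirce_trivial_def)
qed

lemma outer_peirce_trivial_iff:
  assumes "complementary R e u"
  shows "e \<in> outer_peirce_trivial R \<longleftrightarrow> u \<in> inner_peirce_trivial R"
  using complementary_eq[OF assms] complementary_eq[OF complementary_sym[OF assms]]
    complementary_idem[OF assms] complementary_idem[OF complementary_sym[OF assms]]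
  by (simp add: inner_peirce_trivial_def outer_peirce_trivial_def)

lemma peirce_trivial_iff:
  assumes "complementary R e u"
  shows "e \<in> peirce_trivial R \<longleftrightarrow> e \<in> inner_peirce_trivial R \<and> u \<in> inner_peirce_trivial R"
  using outer_peirce_trivial_iff[OF assms] by (simp add: peirce_trivial_def)

lemma peirce_trivial_idem: "e \<in> peirce_trivial R \<Longrightarrow> e \<in> idempotents R"
  by (simp add: peirce_trivial_def inner_peirce_trivial_def)

lemma zero_one_peirce_trivial: "\<zero> \<in> peirce_trivial R" "\<one> \<in> peirce_trivial R"
proof -
  have c: "complementary R \<zero> \<one>" by (simp add: complementary_def)
  show "\<zero> \<in> peirce_trivial R" "\<one> \<in> peirce_trivial R"
    using c complementary_sym[OF c]
    by (auto simp: peirce_trivial_iff inner_peirce_trivial_iff)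
qed

text \<open>
  Splitting \<open>1 - a = (e - a) + (1 - e)\<close> splits \<open>a R (1 - a) R a\<close> into two parts.  The first lies in
  the corner \<open>eRe\<close> because \<open>a\<close> and \<open>e - a\<close> absorb \<open>e\<close>, and vanishes there; the second is contained
  in \<open>a (e R (1 - e) R e) a\<close>.
\<close>

lemma inner_peirce_trivial_corner:
  assumes e: "e \<in> inner_peirce_trivial R"
    and a: "a \<in> inner_peirce_trivial (corner_ring R e)"
  shows "a \<in> inner_peirce_trivial R"
proof -
  have ei: "e \<in> idempotents R" using e by (simp add: inner_peirce_trivial_def)
  interpret C: ring "corner_ring R e" by (rule corner_ring_is_ring[OF ei])
  define u where "u = \<one> \<ominus> e"
  have cu: "complementary R e u" using complementary_one_minus[OF ei] by (simp add: u_def)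
  obtain b where cb: "complementary (corner_ring R e) a b"
    using C.complementary_one_minus a by (auto simp: inner_peirce_trivial_def)
  note D = complementaryD[OF cu] and E = idempotentsD[OF ei]
  have A: "a \<in> carrier R" "e \<otimes> a = a" "a \<otimes> e = a"
    and B: "b \<in> carrier R" "e \<otimes> b = b" "b \<otimes> e = b"
    and ab: "a \<oplus> b = e" "a \<otimes> b = \<zero>" "b \<otimes> a = \<zero>"
    using C.complementaryD[OF cb] corner_carrier_iff[OF ei] by auto
  have au: "a \<otimes> u = \<zero>" "u \<otimes> a = \<zero>"
    using A D by (metis m_assoc r_null, metis m_assoc l_null)
  have c: "complementary R a (b \<oplus> u)"
    using A B D ab au by (auto simp: complementary_def r_distr l_distr simp flip: a_assoc)
  have "a \<otimes> x \<otimes> (b \<oplus> u) \<otimes> y \<otimes> a = \<zero>" if x: "x \<in> carrier R" and y: "y \<in> carrier R" for x y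
  proof -
    have absorb: "a \<otimes> (e \<otimes> z) = a \<otimes> z" "e \<otimes> (b \<otimes> z) = b \<otimes> z" "b \<otimes> (e \<otimes> z) = b \<otimes> z"
      if "z \<in> carrier R" for z
      using that A B E by (simp_all flip: m_assoc)
    have "a \<otimes> (e \<otimes> x \<otimes> e) \<otimes> b \<otimes> (e \<otimes> y \<otimes> e) \<otimes> a = \<zero>"
      using a C.inner_peirce_trivial_iff[OF cb] sandwich_in_corner x y E by simp
    moreover have "a \<otimes> (e \<otimes> x \<otimes> e) \<otimes> b \<otimes> (e \<otimes> y \<otimes> e) \<otimes> a = a \<otimes> x \<otimes> b \<otimes> y \<otimes> a"
      using A B E x y by (simp add: m_assoc absorb)
    moreover have "a \<otimes> x \<otimes> u \<otimes> y \<otimes> a = a \<otimes> (e \<otimes> x \<otimes> u \<otimes> y \<otimes> e) \<otimes> a"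
      using A D E x y by (simp add: m_assoc absorb)
    moreover have "\<dots> = \<zero>"
      using e inner_peirce_trivial_iff[OF cu] A x y by simp
    ultimately show ?thesis
      using A B D x y by (simp add: r_distr l_distr)
  qed
  then show ?thesis using inner_peirce_trivial_iff[OF c] by blast
qed

text \<open>
  Inner Peirce triviality makes \<open>x \<mapsto> exe\<close> multiplicative: the difference of the two sides is
  \<open>e x (1 - e) y e\<close>.
\<close>

lemma inner_peirce_trivial_hom:
  assumes e: "e \<in> inner_peirce_trivial R" and x: "x \<in> carrier R" and y: "y \<in> carrier R"
  shows "(e \<otimes> x \<otimes> e) \<otimes> (e \<otimes> y \<otimes> e) = e \<otimes> (x \<otimes> y) \<otimes> e"
proof -
  have ei: "e \<in> idempotents R" using e by (simp add: inner_peirce_trivial_def)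
  define u where "u = \<one> \<ominus> e"
  have cu: "complementary R e u" using complementary_one_minus[OF ei] by (simp add: u_def)
  note D = complementaryD[OF cu] and E = idempotentsD[OF ei]
  have "e \<otimes> (x \<otimes> y) \<otimes> e = e \<otimes> x \<otimes> (e \<oplus> u) \<otimes> y \<otimes> e"
    unfolding D(3) using E x y by (simp add: m_assoc)
  also have "\<dots> = e \<otimes> x \<otimes> e \<otimes> y \<otimes> e \<oplus> e \<otimes> x \<otimes> u \<otimes> y \<otimes> e"
    using E D(2) x y by (simp add: r_distr l_distr)
  also have "\<dots> = e \<otimes> x \<otimes> e \<otimes> y \<otimes> e"
    using e inner_peirce_trivial_iff[OF cu] E x y by simp
  also have "\<dots> = (e \<otimes> x \<otimes> e) \<otimes> (e \<otimes> y \<otimes> e)"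
    using E x y by (simp add: m_assoc)
  finally show ?thesis by simp
qed

text \<open>
  Since \<open>fef + fuf = f\<close>, this says that \<open>fef\<close> is idempotent.  It is not a direct consequence of
  multiplicativity of \<open>x \<mapsto> exe\<close>, as \<open>f e f u f\<close> is not enclosed between two factors \<open>e\<close>.  Multiplying
  by \<open>1 = e + u\<close> on the left leaves only \<open>e f e f u f\<close>, and this vanishes because \<open>ufu\<close> is idempotent
  and \<open>e f u f = e f (u f u)\<close>.
\<close>

lemma compressions_orthogonal:
  assumes c: "complementary R e u" and e: "e \<in> peirce_trivial R" and f: "f \<in> idempotents R"
  shows "f \<otimes> e \<otimes> f \<otimes> u \<otimes> f = \<zero>"
proof -
  note D = complementaryD[OF c] and F = idempotentsD[OF f]
  have I: "e \<otimes> x \<otimes> u \<otimes> y \<otimes> e = \<zero>" and O: "u \<otimes> x \<otimes> e \<otimes> y \<otimes> u = \<zero>"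
    if "x \<in> carrier R" "y \<in> carrier R" for x y
    using that e inner_peirce_trivial_iff[OF c] inner_peirce_trivial_iff[OF complementary_sym[OF c]]
      peirce_trivial_iff[OF c] by auto
  \<comment> \<open>the Peirce expansions obtained by inserting \<open>1 = e + u\<close>\<close>
  have insert: "x \<otimes> y = x \<otimes> e \<otimes> y \<oplus> x \<otimes> u \<otimes> y" "x = x \<otimes> e \<oplus> x \<otimes> u" "x = e \<otimes> x \<oplus> u \<otimes> x"
    if "x \<in> carrier R" "y \<in> carrier R" for x y
    using that D(1,2) by (simp_all add: D(3) flip: l_distr r_distr)
  have "u \<otimes> f \<otimes> u = u \<otimes> f \<otimes> (f \<otimes> u)" using D F by (simp add: m_assoc)
  also have "\<dots> = u \<otimes> f \<otimes> e \<otimes> (f \<otimes> u) \<oplus> u \<otimes> f \<otimes> u \<otimes> (f \<otimes> u)"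
    using D F by (intro insert) auto
  also have "\<dots> = u \<otimes> f \<otimes> u \<otimes> f \<otimes> u"
    using D F O[of f f] by (simp add: m_assoc)
  finally have d: "u \<otimes> f \<otimes> u = u \<otimes> f \<otimes> u \<otimes> f \<otimes> u" .
  have "e \<otimes> f \<otimes> u \<otimes> f = e \<otimes> f \<otimes> u \<otimes> f \<otimes> e \<oplus> e \<otimes> f \<otimes> u \<otimes> f \<otimes> u"
    using D F by (intro insert) auto
  also have "\<dots> = e \<otimes> f \<otimes> (u \<otimes> f \<otimes> u)"
    using D F I[of f f] by (simp add: m_assoc)
  finally have b: "e \<otimes> f \<otimes> u \<otimes> f = e \<otimes> f \<otimes> (u \<otimes> f \<otimes> u)" .
  have "e \<otimes> f \<otimes> u \<otimes> f \<otimes> u \<otimes> f =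
      e \<otimes> f \<otimes> u \<otimes> f \<otimes> u \<otimes> f \<otimes> e \<oplus> e \<otimes> f \<otimes> u \<otimes> f \<otimes> u \<otimes> f \<otimes> u"
    using D F by (intro insert) auto
  also have "\<dots> = e \<otimes> f \<otimes> (u \<otimes> f \<otimes> u \<otimes> f \<otimes> u)"
    using D F I[of "f \<otimes> u \<otimes> f" f] by (simp add: m_assoc)
  finally have b': "e \<otimes> f \<otimes> u \<otimes> f \<otimes> u \<otimes> f = e \<otimes> f \<otimes> u \<otimes> f"
    using b d by simp
  have "e \<otimes> f \<otimes> u \<otimes> f = e \<otimes> f \<otimes> (f \<otimes> u \<otimes> f)" using D F by (simp add: m_assoc)
  also have "\<dots> = e \<otimes> f \<otimes> e \<otimes> (f \<otimes> u \<otimes> f) \<oplus> e \<otimes> f \<otimes> u \<otimes> (f \<otimes> u \<otimes> f)"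
    using D F by (intro insert) auto
  also have "\<dots> = e \<otimes> f \<otimes> e \<otimes> f \<otimes> u \<otimes> f \<oplus> e \<otimes> f \<otimes> u \<otimes> f"
    using b' D F by (simp add: m_assoc)
  finally have z: "e \<otimes> f \<otimes> e \<otimes> f \<otimes> u \<otimes> f = \<zero>"
    using D F by simp
  have "f \<otimes> e \<otimes> f \<otimes> u \<otimes> f =
      e \<otimes> (f \<otimes> e \<otimes> f \<otimes> u \<otimes> f) \<oplus> u \<otimes> (f \<otimes> e \<otimes> f \<otimes> u \<otimes> f)"
    using D F by (intro insert) auto
  also have "u \<otimes> (f \<otimes> e \<otimes> f \<otimes> u \<otimes> f) = (u \<otimes> f \<otimes> e \<otimes> f \<otimes> u) \<otimes> f"
    using D F by (simp add: m_assoc)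
  also have "\<dots> = \<zero>" using O[of f f] F by simp
  also have "e \<otimes> (f \<otimes> e \<otimes> f \<otimes> u \<otimes> f) = \<zero>" using z D F by (simp add: m_assoc)
  finally show ?thesis by simp
qed

text \<open>
  The trivial products pass to the corner at once, as \<open>f\<close> is absorbed into the arbitrary factors of
  \<open>e R u R e\<close>; only idempotency of \<open>fef\<close> needs an argument.
\<close>

lemma peirce_trivial_compression:
  assumes e: "e \<in> peirce_trivial R" and f: "f \<in> idempotents R"
  shows "f \<otimes> e \<otimes> f \<in> peirce_trivial (corner_ring R f)"
proof -
  define u where "u = \<one> \<ominus> e"
  have c: "complementary R e u"
    using complementary_one_minus[OF peirce_trivial_idem[OF e]] by (simp add: u_def)
  note c' = complementary_sym[OF c]
  have u: "u \<in> peirce_trivial R"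
    using e peirce_trivial_iff[OF c] peirce_trivial_iff[OF c'] by blast
  note D = complementaryD[OF c] and F = idempotentsD[OF f]
  interpret C: ring "corner_ring R f" by (rule corner_ring_is_ring[OF f])
  have "f \<otimes> e \<otimes> f \<oplus> f \<otimes> u \<otimes> f = f \<otimes> (e \<oplus> u) \<otimes> f"
    using D(1,2) F by (simp add: l_distr r_distr)
  then have cf: "complementary (corner_ring R f) (f \<otimes> e \<otimes> f) (f \<otimes> u \<otimes> f)"
    using compressions_orthogonal[OF c e f] compressions_orthogonal[OF c' u f] D F
      sandwich_in_corner
    by (simp add: complementary_def m_assoc)
  have inner: "f \<otimes> p \<otimes> f \<in> inner_peirce_trivial (corner_ring R f)"
    if pq: "complementary R p q" and p: "p \<in> inner_peirce_trivial R"
      and cpq: "complementary (corner_ring R f) (f \<otimes> p \<otimes> f) (f \<otimes> q \<otimes> f)" for p q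
  proof -
    note P = complementaryD[OF pq]
    have "(f \<otimes> p \<otimes> f) \<otimes> x \<otimes> (f \<otimes> q \<otimes> f) \<otimes> y \<otimes> (f \<otimes> p \<otimes> f) = \<zero>"
      if "x \<in> carrier R" "y \<in> carrier R" for x y
    proof -
      have "(f \<otimes> p \<otimes> f) \<otimes> x \<otimes> (f \<otimes> q \<otimes> f) \<otimes> y \<otimes> (f \<otimes> p \<otimes> f)
          = f \<otimes> (p \<otimes> (f \<otimes> x \<otimes> f) \<otimes> q \<otimes> (f \<otimes> y \<otimes> f) \<otimes> p) \<otimes> f"
        using that P F by (simp add: m_assoc)
      also have "\<dots> = \<zero>" using p inner_peirce_trivial_iff[OF pq] that F by simp
      finally show ?thesis .
    qed
    then show ?thesis
      using C.inner_peirce_trivial_iff[OF cpq] corner_carrier_iff[OF f] by simp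
  qed
  show ?thesis
    using C.peirce_trivial_iff[OF cf] inner[OF c _ cf] inner[OF c' _ C.complementary_sym[OF cf]]
      peirce_trivial_iff[OF c] e by blast
qed

end

section \<open>Isomorphism invariance of \<open>1\<close>-Peirce rings\<close>

text \<open>
  Stated with \<open>Suc 0\<close>, the form into which the simplifier rewrites \<open>1\<close>.
\<close>

lemma one_peirce_iff:
  "n_peirce_ring (Suc 0) R \<longleftrightarrow>
    ring R \<and> peirce_trivial R = {\<zero>\<^bsub>R\<^esub>, \<one>\<^bsub>R\<^esub>} \<and> \<zero>\<^bsub>R\<^esub> \<noteq> \<one>\<^bsub>R\<^esub>"
  using n_peirce_ring.one_peirce[of R] by (subst n_peirce_ring.simps) auto

lemma n_peirce_ring_ge_one: "n_peirce_ring n R \<Longrightarrow> 1 \<le> n"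
  by (induction rule: n_peirce_ring.induct) auto

text \<open>
  Surjectivity is essential: the triviality conditions on the image quantify over all elements of
  the target ring, and each of these has to be a value of \<open>h\<close>.
\<close>

lemma peirce_trivial_surjective_image:
  assumes "ring S" "ring R" and h: "h \<in> ring_hom S R" and surj: "h ` carrier S = carrier R"
    and e: "e \<in> peirce_trivial S"
  shows "h e \<in> peirce_trivial R"
proof -
  interpret S: ring S by fact
  interpret R: ring R by fact
  interpret h: ring_hom_ring S R h
    by (rule ring_hom_ringI2) (fact assms)+
  obtain u where c: "complementary S e u"
    using S.complementary_one_minus S.peirce_trivial_idem[OF e] by blast
  have image: "complementary R (h p) (h q)" if "complementary S p q" for p q
    using S.complementaryD[OF that]
    by (simp add: complementary_def flip: h.hom_add h.hom_mult)
  have inner: "h p \<in> inner_peirce_trivial R"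
    if pq: "complementary S p q" and p: "p \<in> inner_peirce_trivial S" for p q
  proof -
    note P = S.complementaryD[OF pq]
    have "h p \<otimes>\<^bsub>R\<^esub> x' \<otimes>\<^bsub>R\<^esub> h q \<otimes>\<^bsub>R\<^esub> y' \<otimes>\<^bsub>R\<^esub> h p = \<zero>\<^bsub>R\<^esub>"
      if "x' \<in> carrier R" "y' \<in> carrier R" for x' y'
    proof -
      obtain x where x: "x \<in> carrier S" "x' = h x"
        using \<open>x' \<in> carrier R\<close> by (auto simp flip: surj)
      obtain y where y: "y \<in> carrier S" "y' = h y"
        using \<open>y' \<in> carrier R\<close> by (auto simp flip: surj)
      have "h (p \<otimes>\<^bsub>S\<^esub> x \<otimes>\<^bsub>S\<^esub> q \<otimes>\<^bsub>S\<^esub> y \<otimes>\<^bsub>S\<^esub> p) = \<zero>\<^bsub>R\<^esub>"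
        using p S.inner_peirce_trivial_iff[OF pq] x y by simp
      then show ?thesis using x y P by simp
    qed
    then show ?thesis by (simp add: R.inner_peirce_trivial_iff[OF image[OF pq]])
  qed
  show ?thesis
    using inner[OF c] inner[OF S.complementary_sym[OF c]] e
    by (simp add: S.peirce_trivial_iff[OF c] R.peirce_trivial_iff[OF image[OF c]])
qed

lemma one_peirce_ring_iso:
  assumes S: "ring S" and R: "n_peirce_ring 1 R" and iso: "h \<in> ring_iso S R"
  shows "n_peirce_ring 1 S"
proof -
  have r: "ring R" "peirce_trivial R = {\<zero>\<^bsub>R\<^esub>, \<one>\<^bsub>R\<^esub>}" "\<zero>\<^bsub>R\<^esub> \<noteq> \<one>\<^bsub>R\<^esub>"
    using R by (simp_all add: one_peirce_iff)
  have h: "h \<in> ring_hom S R" "h ` carrier S = carrier R" "inj_on h (carrier S)"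
    using iso by (auto simp: ring_iso_def bij_betw_def)
  interpret S: ring S by fact
  interpret h: ring_hom_ring S R h
    by (rule ring_hom_ringI2) (fact S r h)+
  have "e = \<zero>\<^bsub>S\<^esub> \<or> e = \<one>\<^bsub>S\<^esub>" if e: "e \<in> peirce_trivial S" for e
  proof -
    have "e \<in> carrier S" using S.idempotentsD(1) S.peirce_trivial_idem[OF e] .
    moreover have "h e = h \<zero>\<^bsub>S\<^esub> \<or> h e = h \<one>\<^bsub>S\<^esub>"
      using peirce_trivial_surjective_image[OF S r(1) h(1,2) e] r(2) by simp
    ultimately show ?thesis using inj_onD[OF h(3)] by blast
  qed
  moreover have "\<zero>\<^bsub>S\<^esub> \<noteq> \<one>\<^bsub>S\<^esub>"
    using r(3) by (auto simp flip: h.hom_zero h.hom_one)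
  ultimately show ?thesis
    using S S.zero_one_peirce_trivial by (auto simp: one_peirce_iff)
qed

context ring
begin

lemma isomorphic_idempotents_transport:
  assumes f: "f \<in> idempotents R" and g: "g \<in> idempotents R"
    and a: "a \<in> carrier R" and b: "b \<in> carrier R" and ab: "a \<otimes> b = f" and ba: "b \<otimes> a = g"
    and "x \<in> carrier (corner_ring R g)"
  shows "a \<otimes> x \<otimes> b \<in> carrier (corner_ring R f)" and "b \<otimes> (a \<otimes> x \<otimes> b) \<otimes> a = x"
proof -
  have x: "x \<in> carrier R" "g \<otimes> x = x" "x \<otimes> g = x"
    using assms(7) corner_carrier_iff[OF g] by auto
  have "f \<otimes> (a \<otimes> x \<otimes> b) = a \<otimes> (g \<otimes> x) \<otimes> b" "(a \<otimes> x \<otimes> b) \<otimes> f = a \<otimes> (x \<otimes> g) \<otimes> b"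
    using a b x(1) by (simp_all add: m_assoc flip: ab ba)
  then show "a \<otimes> x \<otimes> b \<in> carrier (corner_ring R f)"
    using x a b by (simp add: corner_carrier_iff[OF f])
  have "b \<otimes> (a \<otimes> x \<otimes> b) \<otimes> a = g \<otimes> x \<otimes> g"
    using a b x(1) by (simp add: m_assoc flip: ba)
  then show "b \<otimes> (a \<otimes> x \<otimes> b) \<otimes> a = x" using x by simp
qed

text \<open>
  The idempotents \<open>f = ab\<close> and \<open>g = ba\<close> are isomorphic in the sense of Kaplansky, so conjugation by
  \<open>a\<close> and \<open>b\<close> identifies their corners.
\<close>

lemma isomorphic_idempotents_corner_iso:
  assumes f: "f \<in> idempotents R" and g: "g \<in> idempotents R"
    and a: "a \<in> carrier R" and b: "b \<in> carrier R" and ab: "a \<otimes> b = f" and ba: "b \<otimes> a = g"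
  shows "(\<lambda>x. a \<otimes> x \<otimes> b) \<in> ring_iso (corner_ring R g) (corner_ring R f)"
proof (rule ring_iso_memI)
  note to_f = isomorphic_idempotents_transport[OF assms]
    and to_g = isomorphic_idempotents_transport[OF g f b a ba ab]
  show "a \<otimes> x \<otimes> b \<in> carrier (corner_ring R f)" if "x \<in> carrier (corner_ring R g)" for x
    using to_f(1) that .
  show "bij_betw (\<lambda>x. a \<otimes> x \<otimes> b) (carrier (corner_ring R g)) (carrier (corner_ring R f))"
    by (rule bij_betw_byWitness[where f' = "\<lambda>y. b \<otimes> y \<otimes> a"]) (use to_f to_g in auto)
  have "a \<otimes> g \<otimes> b = f \<otimes> f" using a b by (simp add: m_assoc flip: ab ba)
  then show "a \<otimes> \<one>\<^bsub>corner_ring R g\<^esub> \<otimes> b = \<one>\<^bsub>corner_ring R f\<^esub>"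
    using idempotentsD[OF f] by simp
  fix x y assume "x \<in> carrier (corner_ring R g)" "y \<in> carrier (corner_ring R g)"
  then have x: "x \<in> carrier R" and y: "y \<in> carrier R" "g \<otimes> y = y"
    using corner_carrier_iff[OF g] by auto
  have "a \<otimes> x \<otimes> b \<otimes> (a \<otimes> y \<otimes> b) = a \<otimes> x \<otimes> (g \<otimes> y) \<otimes> b"
    using a b x y(1) by (simp add: m_assoc flip: ba)
  then show "a \<otimes> (x \<otimes>\<^bsub>corner_ring R g\<^esub> y) \<otimes> b
      = a \<otimes> x \<otimes> b \<otimes>\<^bsub>corner_ring R f\<^esub> (a \<otimes> y \<otimes> b)"
    using a b x y by (simp add: m_assoc)
  show "a \<otimes> (x \<oplus>\<^bsub>corner_ring R g\<^esub> y) \<otimes> b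
      = a \<otimes> x \<otimes> b \<oplus>\<^bsub>corner_ring R f\<^esub> (a \<otimes> y \<otimes> b)"
    using a b x y(1) by (simp add: l_distr r_distr)
qed

section \<open>Compressing a complete orthogonal family\<close>

lemma complete_orthogonal_familyD:
  assumes "complete_orthogonal_family R I a"
  shows "i \<in> I \<Longrightarrow> a i \<in> idempotents R"
    "i \<in> I \<Longrightarrow> j \<in> I \<Longrightarrow> i \<noteq> j \<Longrightarrow> a i \<otimes> a j = \<zero>"
    "(\<Oplus>i\<in>I. a i) = \<one>"
    "a \<in> I \<rightarrow> carrier R"
  using assms by (auto simp: complete_orthogonal_family_def idempotents_def)

text \<open>
  By multiplicativity of \<open>x \<mapsto> exe\<close> the family stays orthogonal and idempotent with sum \<open>e\<close>.  The
  members with \<open>a i e a i = 0\<close> disappear, since \<open>e (a i) e = e (a i e a i) e\<close>.  For the others,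
  \<open>a i = (a i e)(e a i)\<close> and \<open>e (a i) e = (e a i)(a i e)\<close> are isomorphic idempotents.
\<close>

lemma compressed_family:
  assumes e: "e \<in> inner_peirce_trivial R"
    and I: "finite I" "complete_orthogonal_family R I a" and J: "J \<subseteq> I"
    and full: "\<And>i. i \<in> J \<Longrightarrow> a i \<otimes> e \<otimes> a i = a i"
    and vanish: "\<And>i. i \<in> I - J \<Longrightarrow> a i \<otimes> e \<otimes> a i = \<zero>"
    and one: "\<And>i. i \<in> I \<Longrightarrow> n_peirce_ring 1 (corner_ring R (a i))"
  shows "complete_orthogonal_family (corner_ring R e) J (\<lambda>i. e \<otimes> a i \<otimes> e)"
    and "i \<in> J \<Longrightarrow> n_peirce_ring 1 (corner_ring (corner_ring R e) (e \<otimes> a i \<otimes> e))"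
proof -
  have ei: "e \<in> idempotents R" using e by (simp add: inner_peirce_trivial_def)
  note E = idempotentsD[OF ei] and D = complete_orthogonal_familyD[OF I(2)]
  have A: "a i \<in> carrier R" "a i \<otimes> a i = a i" if "i \<in> I" for i
    using idempotentsD D(1) that by auto
  note hom = inner_peirce_trivial_hom[OF e]
  have idem: "e \<otimes> a i \<otimes> e \<in> idempotents R" if "i \<in> I" for i
    using hom[of "a i" "a i"] A that E by (simp add: idempotents_def)
  have orth: "e \<otimes> a i \<otimes> e \<otimes> (e \<otimes> a j \<otimes> e) = \<zero>" if "i \<in> I" "j \<in> I" "i \<noteq> j" for i j
    using hom[of "a i" "a j"] A D(2) that E by simp
  have zero: "e \<otimes> a i \<otimes> e = \<zero>" if i: "i \<in> I - J" for i
  proof -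
    have "e \<otimes> a i \<otimes> e = (e \<otimes> a i \<otimes> e) \<otimes> (e \<otimes> a i \<otimes> e)"
      using idem idempotentsD(2) i by simp
    also have "\<dots> = e \<otimes> (a i \<otimes> e \<otimes> a i) \<otimes> e"
      using i A E by (simp add: m_assoc)
    finally show ?thesis using vanish[OF i] E by simp
  qed
  have carr: "(\<lambda>i. e \<otimes> a i \<otimes> e) \<in> I \<rightarrow> carrier R" using A E by auto
  have "(\<Oplus>i\<in>J. e \<otimes> a i \<otimes> e) = (\<Oplus>i\<in>I. e \<otimes> a i \<otimes> e)"
    using I(1) J zero carr by (intro add.finprod_mono_neutral_cong_left) auto
  also have "\<dots> = e \<otimes> (\<Oplus>i\<in>I. a i) \<otimes> e"
    using I(1) A E D(4) by (simp add: finsum_ldistr finsum_rdistr Pi_iff)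
  finally have sum: "(\<Oplus>i\<in>J. e \<otimes> a i \<otimes> e) = e" using D(3) E by simp
  have "finsum (corner_ring R e) (\<lambda>i. e \<otimes> a i \<otimes> e) J = (\<Oplus>i\<in>J. e \<otimes> a i \<otimes> e)"
    using finite_subset[OF J I(1)] J A E sandwich_in_corner by (intro finsum_corner[OF ei]) auto
  then show "complete_orthogonal_family (corner_ring R e) J (\<lambda>i. e \<otimes> a i \<otimes> e)"
    using sum idem orth J A E sandwich_in_corner
    by (auto simp: complete_orthogonal_family_def idempotents_def)
  show "n_peirce_ring 1 (corner_ring (corner_ring R e) (e \<otimes> a i \<otimes> e))" if i: "i \<in> J"
  proof -
    have iI: "i \<in> I" using i J by blast
    have "(\<lambda>x. a i \<otimes> e \<otimes> x \<otimes> (e \<otimes> a i))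
        \<in> ring_iso (corner_ring R (e \<otimes> a i \<otimes> e)) (corner_ring R (a i))"
    proof (rule isomorphic_idempotents_corner_iso)
      show "a i \<otimes> e \<otimes> (e \<otimes> a i) = a i" "e \<otimes> a i \<otimes> (a i \<otimes> e) = e \<otimes> a i \<otimes> e"
        using full[OF i] A[OF iI] E by (metis m_assoc m_closed)+
    qed (use idem D(1) iI A E in auto)
    then have "n_peirce_ring 1 (corner_ring R (e \<otimes> a i \<otimes> e))"
      using one_peirce_ring_iso corner_ring_is_ring idem one iI by blast
    then show ?thesis
      using corner_of_corner[OF ei] sandwich_in_corner A iI E by simp
  qed
qed

end

lemma n_peirce_ring_add:
  assumes "ring R" "complementary R e u" "e \<in> peirce_trivial R"
    and "n_peirce_ring k (corner_ring R e)" "n_peirce_ring l (corner_ring R u)"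
  shows "n_peirce_ring (k + l) R"
proof -
  interpret ring R by fact
  have k: "1 \<le> k" and l: "1 \<le> l"
    using assms(4,5) n_peirce_ring_ge_one by auto
  show ?thesis
    by (rule n_peirce_ring.step[OF assms(1) _ assms(3) _ _ assms(4)])
      (use k l assms(5) complementary_eq[OF assms(2)] in simp_all)
qed

text \<open>
  A Peirce trivial \<open>e\<close> other than \<open>0\<close> and \<open>1\<close> compresses in each \<open>1\<close>-Peirce corner to \<open>0\<close> or to the
  unity, and so distributes the index set between \<open>eRe\<close> and \<open>uRu\<close> with \<open>u = 1 - e\<close>.  Both shares are
  nonempty because \<open>e\<close> and \<open>u\<close> are nonzero, which makes the induction on the number of indices
  go down on both sides.
\<close>

lemma n_peirce_of_family:
  assumes "ring R" "\<one>\<^bsub>R\<^esub> \<noteq> \<zero>\<^bsub>R\<^esub>" "finite I" "complete_orthogonal_family R I a"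
    and "\<And>i. i \<in> I \<Longrightarrow> n_peirce_ring 1 (corner_ring R (a i))"
  shows "\<exists>k\<in>{1..card I}. n_peirce_ring k R"
  using assms
proof (induction "card I" arbitrary: R I a rule: less_induct)
  case less
  note I = less.prems(3,4) and one = less.prems(5)
  interpret ring R by fact
  note D = complete_orthogonal_familyD[OF I(2)]
  have I0: "I \<noteq> {}" using D(3) less.prems(2) by auto
  show ?case
  proof (cases "peirce_trivial R = {\<zero>\<^bsub>R\<^esub>, \<one>\<^bsub>R\<^esub>}")
    case True
    then have "n_peirce_ring 1 R" using less.prems by (simp add: one_peirce_iff)
    moreover have "1 \<in> {1..card I}" using I0 I(1) by (simp add: Suc_leI card_gt_0_iff)
    ultimately show ?thesis by blast
  next
    case False
    then obtain e where e: "e \<in> peirce_trivial R" "e \<noteq> \<zero>\<^bsub>R\<^esub>" "e \<noteq> \<one>\<^bsub>R\<^esub>"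
      using zero_one_peirce_trivial by blast
    obtain u where c: "complementary R e u"
      using complementary_one_minus peirce_trivial_idem[OF e(1)] by blast
    note c' = complementary_sym[OF c] and E = complementaryD[OF c]
    have inner: "e \<in> inner_peirce_trivial R" "u \<in> inner_peirce_trivial R"
      using e(1) peirce_trivial_iff[OF c] by auto
    have u0: "u \<noteq> \<zero>\<^bsub>R\<^esub>" using E e(3) by auto
    define J where "J = {i \<in> I. a i \<otimes>\<^bsub>R\<^esub> e \<otimes>\<^bsub>R\<^esub> a i = a i}"
    have dich: "a i \<otimes>\<^bsub>R\<^esub> e \<otimes>\<^bsub>R\<^esub> a i = \<zero>\<^bsub>R\<^esub> \<or> a i \<otimes>\<^bsub>R\<^esub> e \<otimes>\<^bsub>R\<^esub> a i = a i" if "i \<in> I" for i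
      using peirce_trivial_compression[OF e(1) D(1)[OF that]] one[OF that]
      by (auto simp: one_peirce_iff)
    have split: "a i \<otimes>\<^bsub>R\<^esub> e \<otimes>\<^bsub>R\<^esub> a i \<oplus>\<^bsub>R\<^esub> a i \<otimes>\<^bsub>R\<^esub> u \<otimes>\<^bsub>R\<^esub> a i = a i" if "i \<in> I" for i
    proof -
      note A = idempotentsD[OF D(1)[OF that]]
      have "a i \<otimes>\<^bsub>R\<^esub> e \<otimes>\<^bsub>R\<^esub> a i \<oplus>\<^bsub>R\<^esub> a i \<otimes>\<^bsub>R\<^esub> u \<otimes>\<^bsub>R\<^esub> a i = a i \<otimes>\<^bsub>R\<^esub> (e \<oplus>\<^bsub>R\<^esub> u) \<otimes>\<^bsub>R\<^esub> a i"
        using A E(1,2) by (simp add: l_distr r_distr)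
      then show ?thesis using A E(3) by simp
    qed
    have carr: "a i \<otimes>\<^bsub>R\<^esub> u \<otimes>\<^bsub>R\<^esub> a i \<in> carrier R" "a i \<in> carrier R" if "i \<in> I" for i
      using D(1)[OF that] E idempotentsD(1) by auto
    have ue: "a i \<otimes>\<^bsub>R\<^esub> u \<otimes>\<^bsub>R\<^esub> a i = \<zero>\<^bsub>R\<^esub>" if "i \<in> J" for i
      using split[of i] carr[of i] that by (simp add: J_def)
    have uf: "a i \<otimes>\<^bsub>R\<^esub> u \<otimes>\<^bsub>R\<^esub> a i = a i" if "i \<in> I - J" for i
      using split[of i] carr[of i] that dich[of i] by (auto simp: J_def)
    have JI: "J \<subseteq> I" by (auto simp: J_def)
    have eJ: "complete_orthogonal_family (corner_ring R e) J (\<lambda>i. e \<otimes>\<^bsub>R\<^esub> a i \<otimes>\<^bsub>R\<^esub> e)"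
      by (rule compressed_family(1)[OF inner(1) I JI]) (use dich one in \<open>auto simp: J_def\<close>)
    have eJ1: "n_peirce_ring 1 (corner_ring (corner_ring R e) (e \<otimes>\<^bsub>R\<^esub> a i \<otimes>\<^bsub>R\<^esub> e))"
      if "i \<in> J" for i
      by (rule compressed_family(2)[OF inner(1) I JI]) (use dich one that in \<open>auto simp: J_def\<close>)
    have uJ: "complete_orthogonal_family (corner_ring R u) (I - J) (\<lambda>i. u \<otimes>\<^bsub>R\<^esub> a i \<otimes>\<^bsub>R\<^esub> u)"
      by (rule compressed_family(1)[OF inner(2) I Diff_subset[of I J]]) (use ue uf one in auto)
    have uJ1: "n_peirce_ring 1 (corner_ring (corner_ring R u) (u \<otimes>\<^bsub>R\<^esub> a i \<otimes>\<^bsub>R\<^esub> u))"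
      if "i \<in> I - J" for i
      by (rule compressed_family(2)[OF inner(2) I Diff_subset[of I J]]) (use ue uf one that in auto)
    interpret Ce: ring "corner_ring R e"
      by (rule corner_ring_is_ring[OF complementary_idem[OF c]])
    interpret Cu: ring "corner_ring R u"
      by (rule corner_ring_is_ring[OF complementary_idem[OF c']])
    have "J \<noteq> {}" using Ce.complete_orthogonal_familyD(3)[OF eJ] e(2) by auto
    then have less_u: "card (I - J) < card I"
      using JI I(1) by (intro psubset_card_mono) auto
    have "I - J \<noteq> {}"
    proof
      assume empty: "I - J = {}"
      show False using Cu.complete_orthogonal_familyD(3)[OF uJ] u0 unfolding empty by simp
    qed
    then have less_e: "card J < card I"
      using JI I(1) by (intro psubset_card_mono) auto
    have fin: "finite J" "finite (I - J)"
      using JI I(1) finite_subset by auto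
    then have sum: "card J + card (I - J) = card I"
      using JI I(1) by (metis card_Un_disjoint Diff_disjoint Diff_partition)
    have "\<exists>k\<in>{1..card J}. n_peirce_ring k (corner_ring R e)"
      by (rule less.hyps[OF less_e Ce.ring_axioms _ fin(1) eJ eJ1]) (use e(2) in simp_all)
    then obtain k where k: "k \<in> {1..card J}" "n_peirce_ring k (corner_ring R e)" ..
    have "\<exists>l\<in>{1..card (I - J)}. n_peirce_ring l (corner_ring R u)"
      by (rule less.hyps[OF less_u Cu.ring_axioms _ fin(2) uJ uJ1]) (use u0 in simp_all)
    then obtain l where l: "l \<in> {1..card (I - J)}" "n_peirce_ring l (corner_ring R u)" ..
    have "n_peirce_ring (k + l) R"
      using n_peirce_ring_add[OF ring_axioms c e(1) k(2) l(2)] .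
    moreover have "k + l \<in> {1..card I}" using k(1) l(1) sum by auto
    ultimately show ?thesis by blast
  qed
qed

section \<open>Refining Peirce decompositions\<close>

context ring
begin

lemma complete_orthogonal_idempotents_iff_family:
  "complete_orthogonal_idempotents R n a \<longleftrightarrow> complete_orthogonal_family R {1..n} a"
  by (simp add: complete_orthogonal_idempotents_def complete_orthogonal_family_def)

text \<open>
  The only product that can contribute to the \<open>(i, i)\<close>-entry is \<open>a i x (a j) y (a i)\<close>, and
  \<open>a j = (1 - a i) (a j)\<close> puts it into \<open>a i R (1 - a i) R a i\<close>.
\<close>

lemma peirce_matrix_ring_in_T_class:
  assumes fam: "complete_orthogonal_idempotents R n a"
    and inner: "\<And>i. i \<in> {1..n} \<Longrightarrow> a i \<in> inner_peirce_trivial R"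
  shows "peirce_matrix_ring R n a \<in> T_class n"
proof -
  note D = complete_orthogonal_familyD[OF fam[unfolded complete_orthogonal_idempotents_iff_family]]
  let ?A = "peirce_matrix_ring R n a"
  have "(M \<otimes>\<^bsub>?A\<^esub> N) i i = \<zero>"
    if ij: "i \<in> {1..n}" "j \<in> {1..n}" "i \<noteq> j"
      and M: "M \<in> supported_at ?A i j" and N: "N \<in> supported_at ?A j i" for i j M N
  proof -
    note c = complementary_one_minus[OF D(1)[OF ij(1)]]
    note A = idempotentsD(1)[OF D(1)[OF ij(1)]] idempotentsD(1)[OF D(1)[OF ij(2)]]
    have "M i j \<in> peirce_comp R (a i) (a j)" "N j i \<in> peirce_comp R (a j) (a i)"
      using M N ij by (auto simp: supported_at_def peirce_matrix_ring_def)
    then obtain x y where xy: "x \<in> carrier R" "M i j = a i \<otimes> x \<otimes> a j"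
      "y \<in> carrier R" "N j i = a j \<otimes> y \<otimes> a i"
      by (auto simp: peirce_comp_def)
    have "(\<one> \<ominus> a i) \<otimes> a j = a j"
      using A D(2)[OF ij] by (simp add: minus_eq l_distr l_minus)
    then have "M i j \<otimes> N j i = a i \<otimes> x \<otimes> ((\<one> \<ominus> a i) \<otimes> a j) \<otimes> (a j \<otimes> y) \<otimes> a i"
      using xy A by (simp add: m_assoc)
    also have "\<dots> = a i \<otimes> x \<otimes> (\<one> \<ominus> a i) \<otimes> (a j \<otimes> (a j \<otimes> y)) \<otimes> a i"
      using xy A by (simp add: m_assoc)
    also have "\<dots> = \<zero>"
      using inner[OF ij(1)] xy A unfolding inner_peirce_trivial_iff[OF c] by simp
    finally have j: "M i j \<otimes> N j i = \<zero>" .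
    have "M i k \<otimes> N k i = \<zero>" if "k \<in> {1..n}" for k
    proof (cases "k = j")
      case False
      have "N k i \<in> peirce_comp R (a k) (a i)"
        using N ij that by (auto simp: supported_at_def peirce_matrix_ring_def)
      then have "N k i \<in> carrier R"
        using A idempotentsD(1)[OF D(1)[OF that]] by (auto simp: peirce_comp_def)
      moreover have "M i k = \<zero>"
        using M False by (auto simp: supported_at_def peirce_matrix_ring_def)
      ultimately show ?thesis by simp
    qed (use j in simp)
    then have "(\<Oplus>k\<in>{1..n}. M i k \<otimes> N k i) = \<zero>"
      by (intro add.finprod_one_eqI)
    then show ?thesis
      by (simp add: peirce_matrix_ring_def)
  qed
  then show ?thesis
    by (auto simp: T_class_def peirce_matrix_ring_def)
qed

lemma complete_orthogonal_idempotents_append: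
  assumes c: "complementary R e u"
    and a: "complete_orthogonal_idempotents (corner_ring R e) m a"
    and b: "complete_orthogonal_idempotents (corner_ring R u) l b"
  shows "complete_orthogonal_idempotents R (m + l) (\<lambda>i. if i \<le> m then a i else b (i - m))"
proof -
  note ei = complementary_idem[OF c] and ui = complementary_idem[OF complementary_sym[OF c]]
  note E = complementaryD[OF c]
  interpret Ce: ring "corner_ring R e" by (rule corner_ring_is_ring[OF ei])
  interpret Cu: ring "corner_ring R u" by (rule corner_ring_is_ring[OF ui])
  note Da = Ce.complete_orthogonal_familyD[OF a[unfolded Ce.complete_orthogonal_idempotents_iff_family]]
  note Db = Cu.complete_orthogonal_familyD[OF b[unfolded Cu.complete_orthogonal_idempotents_iff_family]]
  have A: "a i \<in> carrier R" "e \<otimes> a i = a i" "a i \<otimes> e = a i" "a i \<otimes> a i = a i"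
    if "i \<in> {1..m}" for i
    using Da(1)[OF that] by (auto simp: idempotents_def corner_carrier_iff[OF ei])
  have B: "b i \<in> carrier R" "u \<otimes> b i = b i" "b i \<otimes> u = b i" "b i \<otimes> b i = b i"
    if "i \<in> {1..l}" for i
    using Db(1)[OF that] by (auto simp: idempotents_def corner_carrier_iff[OF ui])
  have cross: "a i \<otimes> b j = \<zero>" "b j \<otimes> a i = \<zero>" if "i \<in> {1..m}" "j \<in> {1..l}" for i j
  proof -
    note [simp] = A(1)[OF that(1)] B(1)[OF that(2)] E(1,2)
    have "a i \<otimes> b j = (a i \<otimes> e) \<otimes> (u \<otimes> b j)" "b j \<otimes> a i = (b j \<otimes> u) \<otimes> (e \<otimes> a i)"
      using A B that by simp_all
    moreover have "(a i \<otimes> e) \<otimes> (u \<otimes> b j) = a i \<otimes> (e \<otimes> u) \<otimes> b j"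
      "(b j \<otimes> u) \<otimes> (e \<otimes> a i) = b j \<otimes> (u \<otimes> e) \<otimes> a i"
      by (simp_all add: m_assoc)
    ultimately show "a i \<otimes> b j = \<zero>" "b j \<otimes> a i = \<zero>" using E by simp_all
  qed
  let ?c = "\<lambda>i. if i \<le> m then a i else b (i - m)"
  have index: "{1..m + l} = {1..m} \<union> (\<lambda>j. j + m) ` {1..l}"
    unfolding image_add_atLeastAtMost' by auto
  have shift: "i - m \<in> {1..l}" if "i \<in> {1..m + l}" "\<not> i \<le> m" for i
    using that by auto
  have carr: "?c \<in> {1..m} \<rightarrow> carrier R" "?c \<in> (\<lambda>j. j + m) ` {1..l} \<rightarrow> carrier R"
  proof -
    show "?c \<in> {1..m} \<rightarrow> carrier R" using A(1) by auto
    show "?c \<in> (\<lambda>j. j + m) ` {1..l} \<rightarrow> carrier R"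
    proof (rule funcsetI)
      fix i assume "i \<in> (\<lambda>j. j + m) ` {1..l}"
      then obtain j where "j \<in> {1..l}" "i = j + m" by blast
      then show "?c i \<in> carrier R" using B(1) by simp
    qed
  qed
  have "(\<Oplus>i\<in>{1..m + l}. ?c i)
      = (\<Oplus>i\<in>{1..m}. ?c i) \<oplus> (\<Oplus>i\<in>(\<lambda>j. j + m) ` {1..l}. ?c i)"
    unfolding index by (intro finsum_Un_disjoint carr) auto
  also have "(\<Oplus>i\<in>{1..m}. ?c i) = (\<Oplus>i\<in>{1..m}. a i)"
    using A(1) by (intro finsum_cong') auto
  also have "\<dots> = e"
    using Da(3) finsum_corner[OF ei _ Da(4)] by simp
  also have "(\<Oplus>i\<in>(\<lambda>j. j + m) ` {1..l}. ?c i) = (\<Oplus>j\<in>{1..l}. ?c (j + m))"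
    by (intro finsum_reindex carr) auto
  also have "\<dots> = (\<Oplus>j\<in>{1..l}. b j)"
    using B(1) by (intro finsum_cong') auto
  also have "\<dots> = u"
    using Db(3) finsum_corner[OF ui _ Db(4)] by simp
  finally have sum: "(\<Oplus>i\<in>{1..m + l}. ?c i) = \<one>" using E(3) by simp
  have "?c i \<otimes> ?c j = \<zero>" if "i \<in> {1..m + l}" "j \<in> {1..m + l}" "i \<noteq> j" for i j
    using that cross shift[of i] shift[of j] Da(2)[of i j] Db(2)[of "i - m" "j - m"] by auto
  moreover have "?c i \<in> idempotents R" if "i \<in> {1..m + l}" for i
    using that A B shift[of i] by (auto simp: idempotents_def)
  ultimately show ?thesis
    using sum unfolding complete_orthogonal_idempotents_def by blast
qed

end

text \<open>
  The idempotents are the unities of the corners at the leaves of the recursive splitting.  They are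
  Peirce trivial in the last corner that was split; passing up to \<open>R\<close>, only inner triviality is
  transitive, which is why the conclusion is one-sided.
\<close>

lemma n_peirce_decomposition:
  assumes "n_peirce_ring n R"
  shows "\<exists>a. complete_orthogonal_idempotents R n a \<and>
    (\<forall>i\<in>{1..n}. a i \<in> inner_peirce_trivial R \<and> n_peirce_ring 1 (corner_ring R (a i)))"
  using assms
proof induction
  case (one_peirce R)
  interpret ring R by fact
  have "\<one>\<^bsub>R\<^esub> \<in> inner_peirce_trivial R"
    using zero_one_peirce_trivial by (simp add: peirce_trivial_def)
  moreover have "complete_orthogonal_idempotents R 1 (\<lambda>_. \<one>\<^bsub>R\<^esub>)"
    by (simp add: complete_orthogonal_idempotents_def idempotents_def)
  moreover have "n_peirce_ring 1 (corner_ring R \<one>\<^bsub>R\<^esub>)"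
    using one_peirce by (simp add: corner_one one_peirce_iff)
  ultimately show ?case by auto
next
  case (step R n e m)
  interpret ring R by fact
  define u where "u = \<one>\<^bsub>R\<^esub> \<ominus>\<^bsub>R\<^esub> e"
  have c: "complementary R e u"
    using complementary_one_minus[OF peirce_trivial_idem[OF step.hyps(3)]] by (simp add: u_def)
  have inner: "e \<in> inner_peirce_trivial R" "u \<in> inner_peirce_trivial R"
    using step.hyps(3) peirce_trivial_iff[OF c] by auto
  obtain a where a: "complete_orthogonal_idempotents (corner_ring R e) m a"
    "\<And>i. i \<in> {1..m} \<Longrightarrow> a i \<in> inner_peirce_trivial (corner_ring R e)"
    "\<And>i. i \<in> {1..m} \<Longrightarrow> n_peirce_ring 1 (corner_ring (corner_ring R e) (a i))"
    using step.IH(1) by blast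
  obtain b where b: "complete_orthogonal_idempotents (corner_ring R u) (n - m) b"
    "\<And>i. i \<in> {1..n - m} \<Longrightarrow> b i \<in> inner_peirce_trivial (corner_ring R u)"
    "\<And>i. i \<in> {1..n - m} \<Longrightarrow> n_peirce_ring 1 (corner_ring (corner_ring R u) (b i))"
    using step.IH(2) unfolding u_def by blast
  have lift: "x \<in> inner_peirce_trivial R \<and> n_peirce_ring 1 (corner_ring R x)"
    if p: "p \<in> inner_peirce_trivial R" and x: "x \<in> inner_peirce_trivial (corner_ring R p)"
      and one: "n_peirce_ring 1 (corner_ring (corner_ring R p) x)" for p x
  proof -
    have "p \<in> idempotents R" "x \<in> carrier (corner_ring R p)"
      using p x by (auto simp: inner_peirce_trivial_def idempotents_def)
    then show ?thesis
      using inner_peirce_trivial_corner[OF p x] one by (simp add: corner_of_corner)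
  qed
  let ?c = "\<lambda>i. if i \<le> m then a i else b (i - m)"
  have "?c i \<in> inner_peirce_trivial R \<and> n_peirce_ring 1 (corner_ring R (?c i))"
    if "i \<in> {1..n}" for i
  proof (cases "i \<le> m")
    case True
    then show ?thesis
      using that lift[OF inner(1) a(2) a(3), of i] by simp
  next
    case False
    then have "i - m \<in> {1..n - m}" using that by auto
    then show ?thesis
      using False lift[OF inner(2) b(2) b(3), of "i - m"] by simp
  qed
  moreover have "complete_orthogonal_idempotents R n ?c"
    using complete_orthogonal_idempotents_append[OF c a(1) b(1)] \<open>m < n\<close> by simp
  ultimately show ?case by blast
qed

theorem theorem3p7:
  fixes R :: "('a, 'b) ring_scheme"
  assumes "ring R"
  shows "(\<forall>n>1. n_peirce_ring n R \<longrightarrow>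
            (\<exists>e. complete_orthogonal_idempotents R n e \<and>
                 (\<forall>i\<in>{1..n}. e i \<in> inner_peirce_trivial R) \<and>
                 peirce_matrix_ring R n e \<in> T_class n \<and>
                 (\<forall>i\<in>{1..n}. n_peirce_ring 1 (corner_ring R (e i))))) \<and>
         (\<forall>n\<ge>2. (\<exists>e. complete_orthogonal_idempotents R n e \<and>
                     (\<forall>i\<in>{1..n}. n_peirce_ring 1 (corner_ring R (e i)))) \<longrightarrow>
            (\<exists>k\<in>{1..n}. n_peirce_ring k R))"
proof (intro conjI allI impI)
  interpret ring R by fact
  fix n assume "n_peirce_ring n R"
  then obtain e where e: "complete_orthogonal_idempotents R n e"
    "\<And>i. i \<in> {1..n} \<Longrightarrow> e i \<in> inner_peirce_trivial R"
    "\<And>i. i \<in> {1..n} \<Longrightarrow> n_peirce_ring 1 (corner_ring R (e i))"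
    using n_peirce_decomposition by blast
  then show "\<exists>e. complete_orthogonal_idempotents R n e \<and>
                 (\<forall>i\<in>{1..n}. e i \<in> inner_peirce_trivial R) \<and>
                 peirce_matrix_ring R n e \<in> T_class n \<and>
                 (\<forall>i\<in>{1..n}. n_peirce_ring 1 (corner_ring R (e i)))"
    using peirce_matrix_ring_in_T_class[OF e(1,2)] by blast
next
  interpret ring R by fact
  fix n :: nat assume n: "2 \<le> n"
  assume "\<exists>e. complete_orthogonal_idempotents R n e \<and>
      (\<forall>i\<in>{1..n}. n_peirce_ring 1 (corner_ring R (e i)))"
  then obtain e where e: "complete_orthogonal_family R {1..n} e"
    and one: "\<And>i. i \<in> {1..n} \<Longrightarrow> n_peirce_ring 1 (corner_ring R (e i))"
    unfolding complete_orthogonal_idempotents_iff_family by blast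
  have "e 1 \<in> carrier R" "e 1 \<noteq> \<zero>\<^bsub>R\<^esub>"
    using idempotentsD(1)[OF complete_orthogonal_familyD(1)[OF e]] one[of 1] n
    by (auto simp: one_peirce_iff)
  then have "\<one>\<^bsub>R\<^esub> \<noteq> \<zero>\<^bsub>R\<^esub>" using l_one[of "e 1"] l_null[of "e 1"] by metis
  then show "\<exists>k\<in>{1..n}. n_peirce_ring k R"
    using n_peirce_of_family[OF ring_axioms _ _ e one] by simp
qed

end
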